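(* Suppose the Pearson equations $\sigma(x)\tilde w_1'(x)=q_1(x)\tilde w_1(x)$ and $\sigma(x)\tilde w_2'(x)=q_2(x)\tilde w_2(x)$ hold on $\Delta$, where $\sigma,q_1,q_2$ are polynomials and $\sigma\tilde w_1=\sigma\tilde w_2=0$ at the boundary $\partial\Delta$. Then $$\sigma(T)\Phi=-\big(\Phi_1\sigma(T_1)+\Phi_2\sigma(T_2)+q_1(T_1)+q_2(T_2)\big)^\top .$$
   Context: Let $\Delta\subset\mathbb R$ be an interval, $\mathrm d\mu=v(x)\,\mathrm dx$ on $\Delta$, $w_1,w_2$ weights, and $\tilde w_a=w_av$, $a\in\{1,2\}$, with all moments finite. (At an infinite endpoint of $\Delta$, the boundary condition means that $x^k\sigma\tilde w_a\to0$ for all $k$.) All vectors and matrices are semi-infinite, indexed by $0,1,2,\dots$. Put $X(x)=(1,x,x^2,\dots)^\top$, $X_1(x)=(1,0,x,0,x^2,0,\dots)^\top$, $X_2(x)=(0,1,0,x,0,x^2,\dots)^\top$. The moment matrix $g=\int_\Delta X(x)\big(X_1(x)\tilde w_1(x)+X_2(x)\tilde w_2(x)\big)^\top\mathrm dx$ is assumed to have a Gauss–Borel factorization $g=S^{-1}H\tilde S^{-\top}$ with $S,\tilde S$ lower unitriangular and $H=\operatorname{diag}(H_0,H_1,\dots)$, all $H_n\neq0$. $\Lambda$ is the shift matrix with ones on the first superdiagonal and zeros elsewhere; $\Pi_1=\operatorname{diag}(1,0,1,0,\dots)$, $\Pi_2=\operatorname{diag}(0,1,0,1,\dots)$, $\Lambda_a=\Pi_a\Lambda^2$.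 $\mathscr D=\Lambda^\top\operatorname{diag}(1,2,3,\dots)$, $\mathscr D_1=(\Lambda^\top)^2\operatorname{diag}(1,0,2,0,3,0,\dots)$, $\mathscr D_2=(\Lambda^\top)^2\operatorname{diag}(0,1,0,2,0,3,\dots)$. $T=S\Lambda S^{-1}$, $\Phi=S\mathscr DS^{-1}$, and for $a\in\{1,2\}$: $T_a=H^{-1}\tilde S\Lambda_a\tilde S^{-1}H$, $\Phi_a=H^{-1}\tilde S\mathscr D_a\tilde S^{-1}H$, $C_a=H^{-1}\tilde S\Pi_a\tilde S^{-1}H$. For a polynomial $q(x)=\sum_kq_kx^k$, $q(T)=\sum_k q_kT^k$ with $T^0=I$, and $q(T_a)=\sum_kq_kT_a^k$ with the convention $T_a^0:=C_a$. *)

theory Defs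
  imports "HOL-Analysis.Analysis" "HOL-Library.Function_Algebras" "HOL-Library.Groups_Big_Fun"
    "HOL-Computational_Algebra.Polynomial"
begin

section \<open>Semi-infinite matrices\<close>

text \<open>
  Sums, differences and negatives of matrices are the pointwise ones of
  \<^theory>\<open>HOL-Library.Function_Algebras\<close>. The pointwise product \<open>A * B\<close> and the constant
  function \<open>1\<close> of that theory are \<^emph>\<open>not\<close> the matrix product and the identity; these are
  \<open>A \<odot> B\<close> and \<open>idm\<close> below.
\<close>

type_synonym smat = "nat \<Rightarrow> nat \<Rightarrow> real"

text \<open>
  \<^const>\<open>Sum_any\<close> sums over the support and is \<open>0\<close> on an infinite support. In all products used
  below the left factor has finitely supported rows, so every entry is a genuine finite sum.
\<close>

definition mmul :: "smat \<Rightarrow> smat \<Rightarrow> smat" (infixl "\<odot>" 70) where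
  "A \<odot> B = (\<lambda>i j. Sum_any (\<lambda>k. A i k * B k j))"

definition diagm :: "(nat \<Rightarrow> real) \<Rightarrow> smat" where
  "diagm d = (\<lambda>i j. if i = j then d i else 0)"

definition idm :: smat where
  "idm = diagm (\<lambda>_. 1)"

definition mtransp :: "smat \<Rightarrow> smat" where
  "mtransp A = (\<lambda>i j. A j i)"

primrec mpow :: "smat \<Rightarrow> nat \<Rightarrow> smat" where
  "mpow A 0 = idm"
| "mpow A (Suc k) = A \<odot> mpow A k"

definition row_finite :: "smat \<Rightarrow> bool" where
  "row_finite A \<longleftrightarrow> (\<forall>i. finite {j. A i j \<noteq> 0})"

text \<open>
  On matrices with finitely supported rows the product is associative, so a two-sided inverse of
  this kind is unique. Lower unitriangular matrices and diagonal matrices with nonzero diagonal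
  have one.
\<close>

definition minv :: "smat \<Rightarrow> smat" where
  "minv A = (THE B. row_finite B \<and> A \<odot> B = idm \<and> B \<odot> A = idm)"

definition lower_unitriangular :: "smat \<Rightarrow> bool" where
  "lower_unitriangular A \<longleftrightarrow> (\<forall>i. A i i = 1) \<and> (\<forall>i j. i < j \<longrightarrow> A i j = 0)"

text \<open>
  The polynomial \<open>q\<close> evaluated at the matrix \<open>A\<close>, where the zeroth power of \<open>A\<close> is understood to
  be \<open>E\<close>.
\<close>

definition mpoly :: "real poly \<Rightarrow> smat \<Rightarrow> smat \<Rightarrow> smat" where
  "mpoly q E A = (\<Sum>k\<le>degree q. (\<lambda>i j. coeff q k * (if k = 0 then E else mpow A k) i j))"

section \<open>Shift, projection and derivation matrices\<close>

definition Lam :: smat where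
  "Lam = (\<lambda>i j. if j = Suc i then 1 else 0)"

definition Pi1 :: smat where "Pi1 = diagm (\<lambda>n. if even n then 1 else 0)"
definition Pi2 :: smat where "Pi2 = diagm (\<lambda>n. if odd n then 1 else 0)"

definition Lam1 :: smat where "Lam1 = Pi1 \<odot> mpow Lam 2"
definition Lam2 :: smat where "Lam2 = Pi2 \<odot> mpow Lam 2"

definition Der :: smat where
  "Der = mtransp Lam \<odot> diagm (\<lambda>n. real (n + 1))"

definition Der1 :: smat where
  "Der1 = mpow (mtransp Lam) 2 \<odot> diagm (\<lambda>n. if even n then real (n div 2 + 1) else 0)"
definition Der2 :: smat where
  "Der2 = mpow (mtransp Lam) 2 \<odot> diagm (\<lambda>n. if odd n then real (n div 2 + 1) else 0)"

section \<open>The moment matrix\<close>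

definition X0 :: "real \<Rightarrow> nat \<Rightarrow> real" where
  "X0 x n = x ^ n"
definition X1 :: "real \<Rightarrow> nat \<Rightarrow> real" where
  "X1 x n = (if even n then x ^ (n div 2) else 0)"
definition X2 :: "real \<Rightarrow> nat \<Rightarrow> real" where
  "X2 x n = (if odd n then x ^ (n div 2) else 0)"

definition tilde :: "(real \<Rightarrow> real) \<Rightarrow> (real \<Rightarrow> real) \<Rightarrow> real \<Rightarrow> real" where
  "tilde v w = (\<lambda>x. w x * v x)"

definition moment_matrix :: "real set \<Rightarrow> (real \<Rightarrow> real) \<Rightarrow> (real \<Rightarrow> real) \<Rightarrow> smat" where
  "moment_matrix \<Delta> u1 u2 = (\<lambda>i j. LINT x:\<Delta>|lborel. X0 x i * (X1 x j * u1 x + X2 x j * u2 x))"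

definition finite_moments :: "real set \<Rightarrow> (real \<Rightarrow> real) \<Rightarrow> bool" where
  "finite_moments \<Delta> u \<longleftrightarrow> (\<forall>k. set_integrable lborel \<Delta> (\<lambda>x. x ^ k * u x))"

definition gauss_borel :: "smat \<Rightarrow> smat \<Rightarrow> (nat \<Rightarrow> real) \<Rightarrow> smat \<Rightarrow> bool" where
  "gauss_borel g S h St \<longleftrightarrow>
     lower_unitriangular S \<and> lower_unitriangular St \<and> (\<forall>n. h n \<noteq> 0) \<and>
     g = minv S \<odot> diagm h \<odot> mtransp (minv St)"

section \<open>Dressed matrices\<close>

definition Tm :: "smat \<Rightarrow> smat" where "Tm S = S \<odot> Lam \<odot> minv S"
definition Phi :: "smat \<Rightarrow> smat" where "Phi S = S \<odot> Der \<odot> minv S"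

definition dress :: "smat \<Rightarrow> smat \<Rightarrow> smat \<Rightarrow> smat" where
  "dress H St M = minv H \<odot> St \<odot> M \<odot> minv St \<odot> H"

definition T1 :: "smat \<Rightarrow> smat \<Rightarrow> smat" where "T1 H St = dress H St Lam1"
definition T2 :: "smat \<Rightarrow> smat \<Rightarrow> smat" where "T2 H St = dress H St Lam2"
definition Phi1 :: "smat \<Rightarrow> smat \<Rightarrow> smat" where "Phi1 H St = dress H St Der1"
definition Phi2 :: "smat \<Rightarrow> smat \<Rightarrow> smat" where "Phi2 H St = dress H St Der2"
definition C1 :: "smat \<Rightarrow> smat \<Rightarrow> smat" where "C1 H St = dress H St Pi1"
definition C2 :: "smat \<Rightarrow> smat \<Rightarrow> smat" where "C2 H St = dress H St Pi2"

section \<open>Pearson equation and boundary condition\<close>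

text \<open>
  The equation is required at interior points only: at an endpoint belonging to \<open>\<Delta>\<close> the weight
  may be singular, as for Jacobi weights.
\<close>

definition pearson :: "real set \<Rightarrow> real poly \<Rightarrow> real poly \<Rightarrow> (real \<Rightarrow> real) \<Rightarrow> bool" where
  "pearson \<Delta> \<sigma> q u \<longleftrightarrow>
     (\<forall>x\<in>interior \<Delta>. u differentiable (at x) \<and> poly \<sigma> x * deriv u x = poly q x * u x)"

text \<open>
  At a finite endpoint, whether or not it belongs to \<open>\<Delta>\<close>, vanishing is meant as the one-sided
  limit from within \<open>\<Delta>\<close>. This is the boundary value if \<open>u\<close> is continuous there.
\<close>

definition vanishes_at_boundary :: "real set \<Rightarrow> real poly \<Rightarrow> (real \<Rightarrow> real) \<Rightarrow> bool" where
  "vanishes_at_boundary \<Delta> \<sigma> u \<longleftrightarrow>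
     (\<forall>c\<in>frontier \<Delta>. ((\<lambda>x. poly \<sigma> x * u x) \<longlongrightarrow> 0) (at c within \<Delta>)) \<and>
     (\<not> bdd_above \<Delta> \<longrightarrow> (\<forall>k::nat. ((\<lambda>x. x ^ k * poly \<sigma> x * u x) \<longlongrightarrow> 0) at_top)) \<and>
     (\<not> bdd_below \<Delta> \<longrightarrow> (\<forall>k::nat. ((\<lambda>x. x ^ k * poly \<sigma> x * u x) \<longlongrightarrow> 0) at_bot))"

end

theory Submission imports Defs begin

text \<open>
  Let \<open>K = \<sigma>(\<Lambda>) \<D>\<close> and \<open>M = \<D>\<^sub>1 \<sigma>(\<Lambda>\<^sub>1) + \<D>\<^sub>2 \<sigma>(\<Lambda>\<^sub>2) + q\<^sub>1(\<Lambda>\<^sub>1) + q\<^sub>2(\<Lambda>\<^sub>2)\<close>. Since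
  \<open>K X = (\<sigma> X)'\<close> and, by the Pearson equations, \<open>M (X\<^sub>1 u\<^sub>1 + X\<^sub>2 u\<^sub>2) = \<sigma> (X\<^sub>1 u\<^sub>1 + X\<^sub>2 u\<^sub>2)'\<close>
  for the weights \<open>u\<^sub>1, u\<^sub>2\<close> on \<open>\<Delta>\<close>, integration by parts without boundary terms gives
  \<open>K g = - g M\<^sup>T\<close>. Inserting the factorization of \<open>g\<close> turns this into the identity
  \<open>S K S\<inverse> = - (P M P\<inverse>)\<^sup>T\<close> with \<open>P = H\<inverse> S\<^sub>t\<close> (\<open>S\<^sub>t\<close> being the second unitriangular factor), and
  conjugation commutes with products and polynomials. As \<open>g\<close> is a full matrix, each
  reassociation needs finite rows on the left or finite columns on the right.
\<close>

section \<open>Products and inverses of semi-infinite matrices\<close>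

lemma mmul_eq_sum:
  assumes "finite F" "\<And>k. k \<notin> F \<Longrightarrow> A i k * B k j = 0"
  shows "(A \<odot> B) i j = (\<Sum>k\<in>F. A i k * B k j)"
  unfolding mmul_def using assms by (intro Sum_any.expand_superset) auto

lemma mtransp_mmul: "mtransp (A \<odot> B) = mtransp B \<odot> mtransp A"
  by (simp add: mtransp_def mmul_def mult.commute)

lemma mtransp_mtransp [simp]: "mtransp (mtransp A) = A"
  by (simp add: mtransp_def)

lemma mtransp_diagm [simp]: "mtransp (diagm d) = diagm d"
  by (auto simp: mtransp_def diagm_def fun_eq_iff)

lemma row_finite_diagm [simp]: "row_finite (diagm d)"
proof -
  have "{j. diagm d i j \<noteq> 0} \<subseteq> {i}" for i
    by (auto simp: diagm_def)
  then show ?thesis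
    unfolding row_finite_def by (meson finite.simps finite_subset)
qed

lemma row_finite_idm [simp]: "row_finite idm"
  by (simp add: idm_def)

lemma row_finite_lower:
  assumes "lower_unitriangular A" shows "row_finite A"
proof -
  have "{j. A i j \<noteq> 0} \<subseteq> {..i}" for i
    using assms by (auto simp: lower_unitriangular_def) (meson not_le)
  then show ?thesis
    unfolding row_finite_def by (meson finite_atMost finite_subset)
qed

text \<open>For a fixed entry only finitely many pairs \<open>(k, l)\<close> contribute, so two
  finite sums are interchanged. The set \<open>G\<close> is constrained only for \<open>k\<close> in
  \<open>F\<close>; it can therefore come from finite rows of \<open>B\<close> or from a finite
  column of \<open>C\<close>.\<close>

lemma mmul_assoc_entry:
  assumes "finite F" "\<And>k. k \<notin> F \<Longrightarrow> A i k = 0"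
    and "finite G" "\<And>k l. k \<in> F \<Longrightarrow> l \<notin> G \<Longrightarrow> B k l * C l j = 0"
  shows "((A \<odot> B) \<odot> C) i j = (A \<odot> (B \<odot> C)) i j"
proof -
  have AB: "(A \<odot> B) i l = (\<Sum>k\<in>F. A i k * B k l)" for l
    using assms by (intro mmul_eq_sum) auto
  have BC: "(B \<odot> C) k j = (\<Sum>l\<in>G. B k l * C l j)" if "k \<in> F" for k
    using assms that by (intro mmul_eq_sum) auto
  have "((A \<odot> B) \<odot> C) i j = (\<Sum>l\<in>G. (A \<odot> B) i l * C l j)"
  proof (rule mmul_eq_sum[OF assms(3)])
    fix l assume "l \<notin> G"
    then have "(\<Sum>k\<in>F. A i k * (B k l * C l j)) = 0"
      using assms(4) by (intro sum.neutral) auto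
    then show "(A \<odot> B) i l * C l j = 0"
      by (simp add: AB sum_distrib_right mult.assoc)
  qed
  also have "\<dots> = (\<Sum>l\<in>G. \<Sum>k\<in>F. A i k * (B k l * C l j))"
    by (simp add: AB sum_distrib_right mult.assoc)
  also have "\<dots> = (\<Sum>k\<in>F. A i k * (B \<odot> C) k j)"
    by (subst sum.swap) (simp add: BC sum_distrib_left)
  also have "\<dots> = (A \<odot> (B \<odot> C)) i j"
    using assms by (intro mmul_eq_sum[symmetric]) auto
  finally show ?thesis .
qed

lemma mmul_assoc:
  assumes "row_finite A" "row_finite B"
  shows "(A \<odot> B) \<odot> C = A \<odot> (B \<odot> C)"
proof (intro ext)
  fix i j
  let ?F = "{k. A i k \<noteq> 0}"
  show "((A \<odot> B) \<odot> C) i j = (A \<odot> (B \<odot> C)) i j"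
    by (rule mmul_assoc_entry[of ?F _ _ "\<Union>k\<in>?F. {l. B k l \<noteq> 0}"])
      (use assms in \<open>auto simp: row_finite_def\<close>)
qed

text \<open>The middle factor is arbitrary here, which covers products with the full matrix
  \<open>g\<close> or with an upper triangular matrix in the middle.\<close>

lemma mmul_assoc_row_col:
  assumes "row_finite A" "row_finite (mtransp C)"
  shows "(A \<odot> B) \<odot> C = A \<odot> (B \<odot> C)"
proof (intro ext)
  fix i j
  show "((A \<odot> B) \<odot> C) i j = (A \<odot> (B \<odot> C)) i j"
    by (rule mmul_assoc_entry[of "{k. A i k \<noteq> 0}" _ _ "{l. C l j \<noteq> 0}"])
      (use assms in \<open>auto simp: row_finite_def mtransp_def\<close>)
qed

lemma row_finite_mmul [intro]:
  assumes "row_finite A" "row_finite B"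
  shows "row_finite (A \<odot> B)"
  unfolding row_finite_def
proof
  fix i
  let ?F = "{k. A i k \<noteq> 0}"
  have F: "finite ?F" using assms by (auto simp: row_finite_def)
  have "{j. (A \<odot> B) i j \<noteq> 0} \<subseteq> (\<Union>k\<in>?F. {l. B k l \<noteq> 0})"
  proof
    fix j assume "j \<in> {j. (A \<odot> B) i j \<noteq> 0}"
    moreover have "(A \<odot> B) i j = (\<Sum>k\<in>?F. A i k * B k j)"
      by (rule mmul_eq_sum[OF F]) auto
    ultimately obtain k where "k \<in> ?F" "A i k * B k j \<noteq> 0"
      by (auto elim: sum.not_neutral_contains_not_neutral)
    then show "j \<in> (\<Union>k\<in>?F. {l. B k l \<noteq> 0})" by auto
  qed
  moreover have "finite (\<Union>k\<in>?F. {l. B k l \<noteq> 0})"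
    using F assms(2) by (auto simp: row_finite_def)
  ultimately show "finite {j. (A \<odot> B) i j \<noteq> 0}"
    by (rule finite_subset)
qed

lemma row_finite_add [intro]:
  assumes "row_finite A" "row_finite B"
  shows "row_finite (A + B)"
proof -
  have "{j. (A + B) i j \<noteq> 0} \<subseteq> {j. A i j \<noteq> 0} \<union> {j. B i j \<noteq> 0}" for i
    by auto
  then show ?thesis
    using assms unfolding row_finite_def by (meson finite_Un finite_subset)
qed

lemma diagm_mmul: "(diagm d \<odot> A) i j = d i * A i j"
  by (subst mmul_eq_sum[of "{i}"]) (auto simp: diagm_def)

lemma mmul_diagm: "(A \<odot> diagm d) i j = A i j * d j"
  by (subst mmul_eq_sum[of "{j}"]) (auto simp: diagm_def)

lemma idm_mmul [simp]: "idm \<odot> A = A"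
  by (simp add: idm_def diagm_mmul fun_eq_iff)

lemma mmul_idm [simp]: "A \<odot> idm = A"
  by (simp add: idm_def mmul_diagm fun_eq_iff)

text \<open>Negation leaves the support of the summand unchanged, so the default value 0 for
  infinite support occurs on both sides together.\<close>

lemma mmul_uminus_right: "A \<odot> (- B) = - (A \<odot> B)"
  by (simp add: mmul_def fun_eq_iff Sum_any.expand_set sum_negf)

lemma uminus_mmul: "(- A) \<odot> B = - (A \<odot> B)"
  by (simp add: mmul_def fun_eq_iff Sum_any.expand_set sum_negf)

lemma mmul_add_right:
  assumes "row_finite A"
  shows "A \<odot> (B + C) = A \<odot> B + A \<odot> C"
proof (intro ext)
  fix i j
  let ?F = "{k. A i k \<noteq> 0}"
  have "(A \<odot> D) i j = (\<Sum>k\<in>?F. A i k * D k j)" for D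
    by (rule mmul_eq_sum) (use assms in \<open>auto simp: row_finite_def\<close>)
  then show "(A \<odot> (B + C)) i j = (A \<odot> B + A \<odot> C) i j"
    by (simp add: distrib_left sum.distrib)
qed

lemma mmul_add_left:
  assumes "row_finite A" "row_finite B"
  shows "(A + B) \<odot> C = A \<odot> C + B \<odot> C"
proof (intro ext)
  fix i j
  let ?F = "{k. A i k \<noteq> 0} \<union> {k. B i k \<noteq> 0}"
  have F: "finite ?F" using assms by (auto simp: row_finite_def)
  have "(D \<odot> C) i j = (\<Sum>k\<in>?F. D i k * C k j)" if "D \<in> {A, B, A + B}" for D
    by (rule mmul_eq_sum[OF F]) (use that in auto)
  then show "((A + B) \<odot> C) i j = (A \<odot> C + B \<odot> C) i j"
    by (simp add: distrib_right sum.distrib)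
qed

lemma mmul_scale_right:
  assumes "row_finite A"
  shows "A \<odot> (\<lambda>i j. c * B i j) = (\<lambda>i j. c * (A \<odot> B) i j)"
proof (intro ext)
  fix i j
  let ?F = "{k. A i k \<noteq> 0}"
  have "(A \<odot> D) i j = (\<Sum>k\<in>?F. A i k * D k j)" for D
    by (rule mmul_eq_sum) (use assms in \<open>auto simp: row_finite_def\<close>)
  then show "(A \<odot> (\<lambda>i j. c * B i j)) i j = c * (A \<odot> B) i j"
    by (simp add: sum_distrib_left mult.left_commute)
qed

lemma mmul_scale_left:
  assumes "row_finite A"
  shows "(\<lambda>i j. c * A i j) \<odot> B = (\<lambda>i j. c * (A \<odot> B) i j)"
proof (intro ext)
  fix i j
  let ?F = "{k. A i k \<noteq> 0}"
  have F: "finite ?F" using assms by (auto simp: row_finite_def)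
  have "(D \<odot> B) i j = (\<Sum>k\<in>?F. D i k * B k j)" if "D \<in> {A, \<lambda>i j. c * A i j}" for D
    by (rule mmul_eq_sum[OF F]) (use that in auto)
  then show "((\<lambda>i j. c * A i j) \<odot> B) i j = c * (A \<odot> B) i j"
    by (simp add: sum_distrib_left mult.assoc)
qed

lemma row_finite_scale [intro]:
  assumes "row_finite A" shows "row_finite (\<lambda>i j. c * A i j)"
proof -
  have "{j. c * A i j \<noteq> 0} \<subseteq> {j. A i j \<noteq> 0}" for i by auto
  then show ?thesis
    using assms unfolding row_finite_def by (meson finite_subset)
qed

lemma row_finite_zero [simp]: "row_finite 0"
  by (simp add: row_finite_def)

lemma row_finite_sum:
  assumes "\<And>k. k \<in> F \<Longrightarrow> row_finite (N k)"
  shows "row_finite (\<Sum>k\<in>F. N k)"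
  using assms by (induction F rule: infinite_finite_induct) auto

lemma mmul_zero [simp]: "A \<odot> 0 = 0" "0 \<odot> A = 0"
  by (simp_all add: mmul_def fun_eq_iff)

lemma mmul_sum_right:
  assumes "row_finite A"
  shows "A \<odot> (\<Sum>k\<in>F. N k) = (\<Sum>k\<in>F. A \<odot> N k)"
  using assms by (induction F rule: infinite_finite_induct) (auto simp: mmul_add_right)

lemma mmul_sum_left:
  assumes "\<And>k. k \<in> F \<Longrightarrow> row_finite (N k)"
  shows "(\<Sum>k\<in>F. N k) \<odot> B = (\<Sum>k\<in>F. N k \<odot> B)"
  using assms
  by (induction F rule: infinite_finite_induct) (auto simp: mmul_add_left row_finite_sum)

lemma row_finite_mpow:
  assumes "row_finite A" shows "row_finite (mpow A k)"
  using assms by (induction k) auto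

lemma row_finite_mpoly:
  assumes "row_finite E" "row_finite A" shows "row_finite (mpoly q E A)"
  unfolding mpoly_def using assms by (intro row_finite_sum row_finite_scale) (simp add: row_finite_mpow)

section \<open>Uniqueness and existence of inverses\<close>

lemma minv_eq:
  assumes "row_finite A" "row_finite B" "A \<odot> B = idm" "B \<odot> A = idm"
  shows "minv A = B"
  unfolding minv_def
proof (rule the_equality)
  fix C assume C: "row_finite C \<and> A \<odot> C = idm \<and> C \<odot> A = idm"
  then show "C = B"
    using mmul_assoc[of B A C] assms by simp
qed (use assms in simp)

function forward_inverse :: "smat \<Rightarrow> smat" where
  "forward_inverse A i j = (if i = j then 1 else 0) - (\<Sum>k<i. A i k * forward_inverse A k j)"
  by pat_completeness auto
termination by (relation "Wellfounded.measure (\<lambda>(A, i, j). i)") auto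

declare forward_inverse.simps [simp del]

lemma forward_inverse:
  assumes "lower_unitriangular A"
  shows "lower_unitriangular (forward_inverse A)" "A \<odot> forward_inverse A = idm"
proof -
  have up: "i < j \<Longrightarrow> forward_inverse A i j = 0" for i j
  proof (induction i rule: less_induct)
    case (less i)
    then show ?case by (subst forward_inverse.simps) (auto intro!: sum.neutral)
  qed
  moreover have "forward_inverse A i i = 1" for i
    by (subst forward_inverse.simps) (auto intro!: sum.neutral simp: up)
  ultimately show "lower_unitriangular (forward_inverse A)"
    by (simp add: lower_unitriangular_def)
  show "A \<odot> forward_inverse A = idm"
  proof (intro ext)
    fix i j
    have "(A \<odot> forward_inverse A) i j = (\<Sum>k\<le>i. A i k * forward_inverse A k j)"
      using assms by (intro mmul_eq_sum) (auto simp: lower_unitriangular_def)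
    also have "\<dots> = (\<Sum>k<i. A i k * forward_inverse A k j) + forward_inverse A i j"
      using assms by (simp add: lower_unitriangular_def lessThan_Suc_atMost[symmetric])
    \<comment> \<open>Only the last summand is unfolded; its recursion subtracts exactly the sum
      over \<open>k < i\<close>.\<close>
    also have "\<dots> = idm i j"
      by (subst (2) forward_inverse.simps) (simp add: idm_def diagm_def)
    finally show "(A \<odot> forward_inverse A) i j = idm i j" .
  qed
qed

text \<open>Forward substitution yields right inverses only. Applied twice, it gives
  \<open>A \<odot> B = idm\<close> and \<open>B \<odot> C = idm\<close>, whence
  \<open>A = A \<odot> (B \<odot> C) = (A \<odot> B) \<odot> C = C\<close>, and \<open>B\<close> is
  a two-sided inverse.\<close>

lemma minv_lower_unitriangular:
  assumes "lower_unitriangular A"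
  shows "row_finite (minv A)" "A \<odot> minv A = idm" "minv A \<odot> A = idm"
proof -
  define B where "B = forward_inverse A"
  define C where "C = forward_inverse B"
  have B: "lower_unitriangular B" "A \<odot> B = idm"
    using forward_inverse[OF assms] by (auto simp: B_def)
  have C: "lower_unitriangular C" "B \<odot> C = idm"
    using forward_inverse[OF B(1)] by (auto simp: C_def)
  have "A = C"
    using mmul_assoc[of A B C] assms B C by (simp add: row_finite_lower)
  then have "B \<odot> A = idm" using B C by simp
  then have "minv A = B"
    using assms B by (intro minv_eq) (auto simp: row_finite_lower)
  with B \<open>B \<odot> A = idm\<close>
  show "row_finite (minv A)" "A \<odot> minv A = idm" "minv A \<odot> A = idm"
    by (auto simp: row_finite_lower)
qed

lemma minv_diagm:
  assumes "\<And>n. h n \<noteq> 0"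
  shows "minv (diagm h) = diagm (\<lambda>n. inverse (h n))"
proof (rule minv_eq)
  show "diagm h \<odot> diagm (\<lambda>n. inverse (h n)) = idm"
    "diagm (\<lambda>n. inverse (h n)) \<odot> diagm h = idm"
    unfolding fun_eq_iff diagm_mmul using assms by (auto simp: diagm_def idm_def)
qed auto

lemma mpow_conj:
  assumes "row_finite P" "row_finite A" "row_finite Q" "P \<odot> Q = idm" "Q \<odot> P = idm"
  shows "mpow (P \<odot> A \<odot> Q) k = P \<odot> mpow A k \<odot> Q"
proof (induction k)
  case (Suc k)
  \<comment> \<open>Products are normalized to the right, so the cancellation of
    \<open>Q \<odot> P\<close> is needed in front of a further factor.\<close>
  have "Q \<odot> (P \<odot> B) = B" for B
    using assms by (metis mmul_assoc idm_mmul)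
  then show ?case
    using assms Suc by (simp add: mmul_assoc row_finite_mmul row_finite_mpow)
qed (use assms in simp)

text \<open>The substitute \<open>E\<close> for the zeroth power is conjugated along with
  \<open>A\<close>. This covers both conventions: \<open>E = idm\<close>, which conjugation fixes,
  and the projections, which become \<open>C1\<close> and \<open>C2\<close>.\<close>

lemma mpoly_conj:
  assumes "row_finite P" "row_finite A" "row_finite E" "row_finite Q" "P \<odot> Q = idm" "Q \<odot> P = idm"
  shows "mpoly q (P \<odot> E \<odot> Q) (P \<odot> A \<odot> Q) = P \<odot> mpoly q E A \<odot> Q"
proof -
  have *: "P \<odot> (\<Sum>k\<in>F. (\<lambda>i j. c k * N k i j)) \<odot> Q = (\<Sum>k\<in>F. (\<lambda>i j. c k * (P \<odot> N k \<odot> Q) i j))"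
    if "\<And>k. row_finite (N k)" for F :: "nat set" and c N
    using assms that
    by (simp add: mmul_sum_right mmul_sum_left row_finite_mmul row_finite_scale
        mmul_scale_left mmul_scale_right)
  show ?thesis
    unfolding mpoly_def using assms
    by (subst *) (auto simp: row_finite_mpow mpow_conj intro!: sum.cong)
qed

section \<open>Integration by parts\<close>

text \<open>The endpoints are the infimum and supremum in the extended reals, the form in which the
  fundamental theorem of calculus is applied. Finite endpoints lie in the frontier and infinite ones
  mean unboundedness, matching the cases of the boundary condition.\<close>

lemma interval_as_einterval:
  fixes \<Delta> :: "real set"
  assumes "is_interval \<Delta>" "interior \<Delta> \<noteq> {}"
  obtains a b :: ereal where "a < b" "einterval a b = interior \<Delta>" "countable (\<Delta> - interior \<Delta>)"
    "\<And>c. a = ereal c \<Longrightarrow> c \<in> frontier \<Delta>" "\<And>c. b = ereal c \<Longrightarrow> c \<in> frontier \<Delta>"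
    "a = -\<infinity> \<Longrightarrow> \<not> bdd_below \<Delta>" "b = \<infinity> \<Longrightarrow> \<not> bdd_above \<Delta>"
proof -
  define a where "a = Inf (ereal ` \<Delta>)"
  define b where "b = Sup (ereal ` \<Delta>)"
  have mem: "a \<le> ereal x \<and> ereal x \<le> b" if "x \<in> \<Delta>" for x
    using that by (auto simp: a_def b_def INF_lower SUP_upper)
  have sub: "einterval a b \<subseteq> \<Delta>"
  proof
    fix x assume "x \<in> einterval a b"
    then obtain y z where "y \<in> \<Delta>" "y < x" "z \<in> \<Delta>" "x < z"
      by (auto simp: einterval_iff a_def b_def Inf_less_iff less_Sup_iff)
    then show "x \<in> \<Delta>"
      using assms(1) by (meson is_interval_1 less_imp_le)
  qed
  have int: "einterval a b = interior \<Delta>"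
  proof
    show "einterval a b \<subseteq> interior \<Delta>"
      using sub by (simp add: interior_maximal)
    show "interior \<Delta> \<subseteq> einterval a b"
    proof
      fix x assume "x \<in> interior \<Delta>"
      then obtain e where e: "e > 0" "cball x e \<subseteq> \<Delta>"
        by (auto simp: mem_interior_cball)
      then have "x - e \<in> \<Delta>" "x + e \<in> \<Delta>"
        by (auto simp: subset_iff dist_real_def)
      then have "a \<le> ereal (x - e)" "ereal (x + e) \<le> b"
        using mem by auto
      moreover have "ereal (x - e) < ereal x" "ereal x < ereal (x + e)"
        using e by auto
      ultimately show "x \<in> einterval a b"
        unfolding einterval_iff by (meson le_less_trans less_le_trans)
    qed
  qed
  have ne: "\<Delta> \<noteq> {}" using assms(2) by auto
  have "a < b"
    using assms(2) unfolding int[symmetric] by (auto simp: einterval_iff dest: less_trans)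
  moreover have "countable (\<Delta> - interior \<Delta>)"
  proof (rule countable_finite, rule finite_subset)
    \<comment> \<open>Only finite endpoints can belong to the difference; an infinite one is sent to
      0, which merely enlarges the set on the right.\<close>
    show "\<Delta> - interior \<Delta> \<subseteq> {real_of_ereal a, real_of_ereal b}"
      using mem unfolding int[symmetric] by (force simp: einterval_iff order.order_iff_strict)
  qed auto
  moreover have "c \<in> frontier \<Delta>" if "a = ereal c" for c
  proof -
    have "c \<notin> interior \<Delta>"
      using that unfolding int[symmetric] by (simp add: einterval_iff)
    moreover have "c \<in> closure \<Delta>"
      unfolding closure_approachable
    proof (intro allI impI)
      fix e :: real assume "e > 0"
      then have "Inf (ereal ` \<Delta>) < ereal (c + e)"
        using that by (simp add: a_def)
      then obtain y where "y \<in> \<Delta>" "y < c + e" by (auto simp: Inf_less_iff)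
      then show "\<exists>y\<in>\<Delta>. dist y c < e"
        using mem[of y] that by (intro bexI[of _ y]) (auto simp: dist_real_def)
    qed
    ultimately show ?thesis by (simp add: frontier_def)
  qed
  moreover have "c \<in> frontier \<Delta>" if "b = ereal c" for c
  proof -
    have "c \<notin> interior \<Delta>"
      using that unfolding int[symmetric] by (simp add: einterval_iff)
    moreover have "c \<in> closure \<Delta>"
      unfolding closure_approachable
    proof (intro allI impI)
      fix e :: real assume "e > 0"
      then have "ereal (c - e) < Sup (ereal ` \<Delta>)"
        using that by (simp add: b_def)
      then obtain y where "y \<in> \<Delta>" "c - e < y" by (auto simp: less_Sup_iff)
      then show "\<exists>y\<in>\<Delta>. dist y c < e"
        using mem[of y] that by (intro bexI[of _ y]) (auto simp: dist_real_def)
    qed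
    ultimately show ?thesis by (simp add: frontier_def)
  qed
  moreover have "\<not> bdd_below \<Delta>" if "a = -\<infinity>"
  proof
    assume "bdd_below \<Delta>"
    then obtain m where "\<And>x. x \<in> \<Delta> \<Longrightarrow> m \<le> x" by (auto simp: bdd_below_def)
    then have "ereal m \<le> a" unfolding a_def by (auto intro!: INF_greatest)
    with that show False by simp
  qed
  moreover have "\<not> bdd_above \<Delta>" if "b = \<infinity>"
  proof
    assume "bdd_above \<Delta>"
    then obtain m where "\<And>x. x \<in> \<Delta> \<Longrightarrow> x \<le> m" by (auto simp: bdd_above_def)
    then have "b \<le> ereal m" unfolding b_def by (auto intro!: SUP_least)
    with that show False by simp
  qed
  ultimately show thesis by (rule that[OF _ int])
qed

section \<open>Moments and vanishing integrals from the Pearson equation\<close>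

lemma tendsto_zero_poly_mult:
  fixes f :: "real \<Rightarrow> real"
  assumes "\<And>k. ((\<lambda>x. x ^ k * f x) \<longlongrightarrow> 0) F"
  shows "((\<lambda>x. poly p x * f x) \<longlongrightarrow> 0) F"
  unfolding poly_altdef sum_distrib_right mult.assoc
  by (intro tendsto_null_sum tendsto_mult_right_zero assms)

definition moment :: "real set \<Rightarrow> (real \<Rightarrow> real) \<Rightarrow> nat \<Rightarrow> real" where
  "moment \<Delta> u n = (LINT x:\<Delta>|lborel. x ^ n * u x)"

lemma moment_sum:
  assumes "finite_moments \<Delta> u" "finite F"
  shows "set_integrable lborel \<Delta> (\<lambda>x. (\<Sum>k\<in>F. c k * x ^ e k) * u x)"
    and "(LINT x:\<Delta>|lborel. (\<Sum>k\<in>F. c k * x ^ e k) * u x) = (\<Sum>k\<in>F. c k * moment \<Delta> u (e k))"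
proof -
  have I: "set_integrable lborel \<Delta> (\<lambda>x. x ^ n * u x)" for n
    using assms(1) by (simp add: finite_moments_def)
  \<comment> \<open>Both claims share one induction, since additivity of the integral needs
    integrability of the partial sum.\<close>
  have "set_integrable lborel \<Delta> (\<lambda>x. (\<Sum>k\<in>F. c k * x ^ e k) * u x) \<and>
    (LINT x:\<Delta>|lborel. (\<Sum>k\<in>F. c k * x ^ e k) * u x) = (\<Sum>k\<in>F. c k * moment \<Delta> u (e k))"
    using assms(2)
  proof induction
    case empty
    then show ?case by (simp add: set_integrable_def set_lebesgue_integral_def)
  next
    case (insert k F)
    have "set_integrable lborel \<Delta> (\<lambda>x. c k * (x ^ e k * u x))"
      using I by simp
    with insert show ?case
      by (simp add: distrib_right mult.assoc set_integral_add moment_def)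
  qed
  then show "set_integrable lborel \<Delta> (\<lambda>x. (\<Sum>k\<in>F. c k * x ^ e k) * u x)"
    "(LINT x:\<Delta>|lborel. (\<Sum>k\<in>F. c k * x ^ e k) * u x) = (\<Sum>k\<in>F. c k * moment \<Delta> u (e k))"
    by auto
qed

lemma set_integrable_poly_mult:
  assumes "finite_moments \<Delta> u"
  shows "set_integrable lborel \<Delta> (\<lambda>x. poly p x * u x)"
  unfolding poly_altdef using assms by (intro moment_sum(1)) auto

text \<open>
  By the Pearson equation the integrand is the derivative of \<open>p \<sigma> u\<close> on the interior of \<open>\<Delta>\<close>.
\<close>

lemma pearson_integral_zero:
  assumes "is_interval \<Delta>" "finite_moments \<Delta> u" "pearson \<Delta> \<sigma> q u" "vanishes_at_boundary \<Delta> \<sigma> u"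
  shows "(LINT x:\<Delta>|lborel. poly (pderiv (p * \<sigma>) + p * q) x * u x) = 0"
proof (cases "interior \<Delta> = {}")
  case True
  \<comment> \<open>A degenerate interval has at most one point, hence measure zero.\<close>
  then have "\<exists>c. \<Delta> \<subseteq> {c}"
  proof -
    have "x = y" if "x \<in> \<Delta>" "y \<in> \<Delta>" for x y
    proof (rule ccontr)
      assume "x \<noteq> y"
      then obtain l r where lr: "l < r" "l \<in> \<Delta>" "r \<in> \<Delta>"
        using \<open>x \<in> \<Delta>\<close> \<open>y \<in> \<Delta>\<close> by (meson linorder_neq_iff)
      then have "{l<..<r} \<subseteq> \<Delta>"
        using assms(1) by (meson greaterThanLessThan_iff is_interval_1 less_imp_le subsetI)
      then have "{l<..<r} \<subseteq> interior \<Delta>" by (simp add: interior_maximal)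
      with True lr show False by simp
    qed
    then show ?thesis by blast
  qed
  then obtain c where "\<Delta> \<subseteq> {c}" ..
  have "(LINT x:\<Delta>|lborel. f x) = (LINT x:{}|lborel. f x)" for f :: "real \<Rightarrow> real"
    unfolding set_lebesgue_integral_def
    by (rule integral_discrete_difference[of "{c}"])
      (use \<open>\<Delta> \<subseteq> {c}\<close> in \<open>auto simp: indicator_def\<close>)
  then show ?thesis by (simp add: set_lebesgue_integral_def)
next
  case False
  obtain a b :: ereal where ab: "a < b" "einterval a b = interior \<Delta>" "countable (\<Delta> - interior \<Delta>)"
    and fa: "\<And>c. a = ereal c \<Longrightarrow> c \<in> frontier \<Delta>" and fb: "\<And>c. b = ereal c \<Longrightarrow> c \<in> frontier \<Delta>"
    and ia: "a = -\<infinity> \<Longrightarrow> \<not> bdd_below \<Delta>" and ib: "b = \<infinity> \<Longrightarrow> \<not> bdd_above \<Delta>"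
    using interval_as_einterval[OF assms(1) False] by blast
  define f where "f = (\<lambda>x. poly (pderiv (p * \<sigma>) + p * q) x * u x)"
  define F where "F = (\<lambda>x. poly p x * (poly \<sigma> x * u x))"
  \<comment> \<open>An interior point separating the two ends, used to localize the one-sided
    limits.\<close>
  obtain d where d: "a < ereal d" "ereal d < b"
    using ab(1) ereal_dense2 by blast
  have sub: "einterval a b \<subseteq> \<Delta>"
    using ab(2) interior_subset by auto
  have int: "set_integrable lborel \<Delta> f"
    unfolding f_def by (rule set_integrable_poly_mult[OF assms(2)])
  have u: "u differentiable (at x)" "poly \<sigma> x * deriv u x = poly q x * u x"
    if "a < ereal x" "ereal x < b" for x
    using assms(3) that ab(2) by (auto simp: pearson_def einterval_iff)
  have "(LBINT x=a..b. f x) = 0 - 0"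
  proof (rule interval_integral_FTC_integrable[OF ab(1), where F = F])
    fix x assume x: "a < ereal x" "ereal x < b"
    have "(u has_real_derivative deriv u x) (at x)"
      using u(1)[OF x] by (simp add: DERIV_deriv_iff_real_differentiable)
    then have "(F has_real_derivative
        poly (pderiv p) x * (poly \<sigma> x * u x) + (poly (pderiv \<sigma>) x * u x + deriv u x * poly \<sigma> x) * poly p x) (at x)"
      unfolding F_def by (intro DERIV_mult poly_DERIV)
    \<comment> \<open>The Pearson equation replaces \<sigma> u' by q u.\<close>
    moreover have "poly (pderiv p) x * (poly \<sigma> x * u x) + (poly (pderiv \<sigma>) x * u x + deriv u x * poly \<sigma> x) * poly p x = f x"
      using u(2)[OF x] by (simp add: f_def pderiv_mult algebra_simps)
    ultimately show "(F has_vector_derivative f x) (at x)"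
      by (simp add: has_real_derivative_iff_has_vector_derivative)
    show "isCont f x"
      unfolding f_def using u(1)[OF x]
      by (intro continuous_mult poly_isCont) (auto dest: differentiable_imp_continuous_within)
  next
    show "set_integrable lborel (einterval a b) f"
      by (rule set_integrable_subset[OF int _ sub]) simp
    show "((F \<circ> real_of_ereal) \<longlongrightarrow> 0) (at_right a)"
    proof (cases a)
      case (real c)
      have "((\<lambda>x. poly \<sigma> x * u x) \<longlongrightarrow> 0) (at c within \<Delta>)"
        using fa[OF real] assms(4) by (simp add: vanishes_at_boundary_def)
      moreover have "{c<..<d} \<subseteq> \<Delta>"
      proof (rule subset_trans[OF _ sub], rule subsetI)
        fix x assume "x \<in> {c<..<d}"
        then have "a < ereal x" "ereal x < ereal d" by (simp_all add: real del: ereal_less_eq)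
        then show "x \<in> einterval a b" using d by (meson einterval_iff less_trans)
      qed
      ultimately have "((\<lambda>x. poly \<sigma> x * u x) \<longlongrightarrow> 0) (at c within {c<..<d})"
        by (rule tendsto_within_subset)
      \<comment> \<open>The limit within \<open>\<Delta>\<close> restricts to
        \<open>{c<..<d}\<close>, which near \<open>c\<close> coincides with the right
        half-line.\<close>
      moreover have "at c within {c<..<d} = at_right c"
        by (rule at_within_nhd[of _ "{..<d}"]) (use d real in auto)
      ultimately have "(F \<longlongrightarrow> poly p c * 0) (at_right c)"
        unfolding F_def by (intro tendsto_intros) auto
      then show ?thesis by (simp add: real ereal_tendsto_simps)
    next
      case MInf
      \<comment> \<open>At an infinite end the factor \<open>p\<close> is unbounded in general;
        decay against every power of x absorbs it.\<close>
      then have "(F \<longlongrightarrow> 0) at_bot"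
        unfolding F_def using ia assms(4)
        by (intro tendsto_zero_poly_mult) (simp add: vanishes_at_boundary_def mult.assoc)
      then show ?thesis by (simp add: MInf ereal_tendsto_simps)
    qed (use ab in auto)
    show "((F \<circ> real_of_ereal) \<longlongrightarrow> 0) (at_left b)"
    proof (cases b)
      case (real c)
      have "((\<lambda>x. poly \<sigma> x * u x) \<longlongrightarrow> 0) (at c within \<Delta>)"
        using fb[OF real] assms(4) by (simp add: vanishes_at_boundary_def)
      moreover have "{d<..<c} \<subseteq> \<Delta>"
      proof (rule subset_trans[OF _ sub], rule subsetI)
        fix x assume "x \<in> {d<..<c}"
        then have "ereal d < ereal x" "ereal x < b" by (simp_all add: real)
        then show "x \<in> einterval a b" using d by (meson einterval_iff less_trans)
      qed
      ultimately have "((\<lambda>x. poly \<sigma> x * u x) \<longlongrightarrow> 0) (at c within {d<..<c})"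
        by (rule tendsto_within_subset)
      moreover have "at c within {d<..<c} = at_left c"
        by (rule at_within_nhd[of _ "{d<..}"]) (use d real in auto)
      ultimately have "(F \<longlongrightarrow> poly p c * 0) (at_left c)"
        unfolding F_def by (intro tendsto_intros) auto
      then show ?thesis by (simp add: real ereal_tendsto_simps)
    next
      case PInf
      then have "(F \<longlongrightarrow> 0) at_top"
        unfolding F_def using ib assms(4)
        by (intro tendsto_zero_poly_mult) (simp add: vanishes_at_boundary_def mult.assoc)
      then show ?thesis by (simp add: PInf ereal_tendsto_simps)
    qed (use ab in auto)
  qed
  then have "(LINT x:einterval a b|lborel. f x) = 0"
    using ab(1) by (simp add: interval_lebesgue_integral_def less_imp_le)
  also have "(LINT x:einterval a b|lborel. f x) = (LINT x:\<Delta>|lborel. f x)"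
    unfolding set_lebesgue_integral_def
    by (rule integral_discrete_difference[OF ab(3)])
      (use sub ab(2) in \<open>auto simp: indicator_def\<close>)
  finally show ?thesis by (simp add: f_def)
qed

text \<open>
  At \<open>n + k = 0\<close> the truncated subtraction is harmless because of the factor \<open>real (n + k)\<close>.
\<close>

lemma pearson_moments:
  assumes "is_interval \<Delta>" "finite_moments \<Delta> u" "pearson \<Delta> \<sigma> q u" "vanishes_at_boundary \<Delta> \<sigma> u"
  shows "(\<Sum>k\<le>degree \<sigma>. coeff \<sigma> k * (real (n + k) * moment \<Delta> u (n + k - 1))) +
    (\<Sum>k\<le>degree q. coeff q k * moment \<Delta> u (n + k)) = 0"
proof -
  have pderiv_sum: "pderiv (\<Sum>k\<in>F. f k) = (\<Sum>k\<in>F. pderiv (f k))" for F and f :: "nat \<Rightarrow> real poly"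
    by (induction F rule: infinite_finite_induct) (auto simp: pderiv_add)
  have "monom 1 n * \<sigma> = (\<Sum>k\<le>degree \<sigma>. monom (coeff \<sigma> k) (n + k))"
    by (subst (1) poly_as_sum_of_monoms[symmetric]) (simp add: sum_distrib_left mult_monom)
  then have "pderiv (monom 1 n * \<sigma>) = (\<Sum>k\<le>degree \<sigma>. monom (real (n + k) * coeff \<sigma> k) (n + k - 1))"
    by (simp add: pderiv_sum pderiv_monom del: of_nat_add)
  then have 1: "poly (pderiv (monom 1 n * \<sigma>)) x = (\<Sum>k\<le>degree \<sigma>. (coeff \<sigma> k * real (n + k)) * x ^ (n + k - 1))" for x
    by (simp add: poly_sum poly_monom mult_ac del: of_nat_add)
  have 2: "poly (monom 1 n * q) x = (\<Sum>k\<le>degree q. coeff q k * x ^ (n + k))" for x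
    by (simp add: poly_monom poly_altdef[of q] sum_distrib_left power_add mult_ac)
  \<comment> \<open>The vanishing integral is used with p = x^n.\<close>
  have "0 = (LINT x:\<Delta>|lborel. poly (pderiv (monom 1 n * \<sigma>) + monom 1 n * q) x * u x)"
    using pearson_integral_zero[OF assms] by simp
  also have "\<dots> = (LINT x:\<Delta>|lborel. (\<Sum>k\<le>degree \<sigma>. (coeff \<sigma> k * real (n + k)) * x ^ (n + k - 1)) * u x) +
     (LINT x:\<Delta>|lborel. (\<Sum>k\<le>degree q. coeff q k * x ^ (n + k)) * u x)"
    unfolding poly_add distrib_right 1 2
    by (intro set_integral_add moment_sum(1)[OF assms(2)]) auto
  also have "\<dots> = (\<Sum>k\<le>degree \<sigma>. coeff \<sigma> k * real (n + k) * moment \<Delta> u (n + k - 1)) +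
    (\<Sum>k\<le>degree q. coeff q k * moment \<Delta> u (n + k))"
    by (simp only: moment_sum(2)[OF assms(2)] finite_atMost)
  finally show ?thesis by (simp add: mult.assoc)
qed

text \<open>For each \<open>j\<close> exactly one of \<open>X1 x j\<close> and \<open>X2 x j\<close>
  survives, so each entry is a single moment of one of the two weights.\<close>

lemma moment_matrix_entry:
  "moment_matrix \<Delta> u1 u2 i j = moment \<Delta> (if even j then u1 else u2) (i + j div 2)"
  by (simp add: moment_matrix_def moment_def X0_def X1_def X2_def power_add mult.assoc)

section \<open>Action on the moment matrix\<close>

lemma Lam_mmul: "(Lam \<odot> B) i j = B (Suc i) j"
  by (subst mmul_eq_sum[of "{Suc i}"]) (auto simp: Lam_def)

lemma row_finite_Lam [simp]: "row_finite Lam"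
  unfolding row_finite_def Lam_def by simp

lemma mtransp_Lam_mmul: "(mtransp Lam \<odot> B) i j = (if i = 0 then 0 else B (i - 1) j)"
  by (subst mmul_eq_sum[of "{i - 1}"]) (auto simp: Lam_def mtransp_def)

lemma row_finite_mtransp_Lam [simp]: "row_finite (mtransp Lam)"
  unfolding row_finite_def
proof
  fix i
  have "{j. mtransp Lam i j \<noteq> 0} \<subseteq> {i - 1}" by (auto simp: mtransp_def Lam_def)
  then show "finite {j. mtransp Lam i j \<noteq> 0}" by (rule finite_subset) simp
qed

lemma mpow_Lam_mmul: "(mpow Lam k \<odot> B) i j = B (i + k) j"
  by (induction k arbitrary: i) (simp_all add: mmul_assoc row_finite_mpow Lam_mmul)

lemma mpoly_mmul:
  assumes "row_finite E" "row_finite A"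
  shows "(mpoly q E A \<odot> B) i j =
    (\<Sum>k\<le>degree q. coeff q k * ((if k = 0 then E else mpow A k) \<odot> B) i j)"
proof -
  have sum_apply: "(\<Sum>k\<in>F. N k) i j = (\<Sum>k\<in>F. N k i j)" for F :: "nat set" and N :: "nat \<Rightarrow> smat"
    by (induction F rule: infinite_finite_induct) auto
  have "row_finite (if k = 0 then E else mpow A k)" for k
    using assms by (simp add: row_finite_mpow)
  then show ?thesis
    unfolding mpoly_def by (simp only: mmul_sum_left mmul_scale_left row_finite_scale sum_apply)
qed

text \<open>Row form of (x^i \<sigma>)': each term of \<sigma> contributes x^(i+k), whose derivative
  is (i+k) x^(i+k-1). The factor \<open>real (i + k)\<close> vanishes when the subtraction
  truncates.\<close>

lemma mpoly_Lam_Der_mmul: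
  "(mpoly \<sigma> idm Lam \<odot> Der \<odot> B) i j =
    (\<Sum>k\<le>degree \<sigma>. coeff \<sigma> k * (real (i + k) * B (i + k - 1) j))"
proof -
  have Der: "(Der \<odot> B) n j = real n * B (n - 1) j" for n
    by (cases n) (simp_all add: Der_def mmul_assoc mtransp_Lam_mmul diagm_mmul)
  have "((if k = 0 then idm else mpow Lam k) \<odot> (Der \<odot> B)) i j = (Der \<odot> B) (i + k) j" for k
    by (simp add: mpow_Lam_mmul)
  moreover have "row_finite Der" by (auto simp: Der_def)
  ultimately show ?thesis
    by (simp add: mmul_assoc row_finite_mpoly mpoly_mmul Der del: of_nat_add)
qed

text \<open>
  The two families \<open>Pi1, Lam1, Der1\<close> and \<open>Pi2, Lam2, Der2\<close> are the instances \<open>P = even\<close> and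
  \<open>P = odd\<close>.
\<close>

context
  fixes P :: "nat \<Rightarrow> bool" and E L D :: smat
  assumes P: "\<And>n. P (Suc (Suc n)) = P n"
    and E_def: "E = diagm (\<lambda>n. if P n then 1 else 0)"
    and L_def: "L = E \<odot> mpow Lam 2"
    and D_def: "D = mpow (mtransp Lam) 2 \<odot> diagm (\<lambda>n. if P n then real (n div 2 + 1) else 0)"
begin

lemma row_finite_parity: "row_finite E" "row_finite L" "row_finite D"
  by (simp_all add: E_def L_def D_def row_finite_mpow row_finite_mmul)

lemma parity_add_double: "P (n + 2 * k) = P n"
  by (induction k) (simp_all add: P)

text \<open>On rows of parity \<open>P\<close>, \<open>L\<close> acts as multiplication by x, that
  is, an index shift by two; the other rows are annihilated. Using \<open>E\<close> as zeroth power
  gives the constant term the same projection.\<close>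

lemma mpoly_parity_mmul:
  "(mpoly q E L \<odot> B) i j = (if P i then \<Sum>k\<le>degree q. coeff q k * B (i + 2 * k) j else 0)"
proof -
  have L: "(L \<odot> C) i j = (if P i then C (i + 2) j else 0)" for C i
    by (simp add: L_def E_def mmul_assoc row_finite_mpow diagm_mmul mpow_Lam_mmul)
  \<comment> \<open>Positive powers only: \<open>mpow L 0\<close> is the identity and would not
    annihilate the rows of the other parity.\<close>
  have pow: "(mpow L (Suc k) \<odot> B) i j = (if P i then B (i + 2 * Suc k) j else 0)" for k i
  proof (induction k arbitrary: i)
    case (Suc k)
    have "(mpow L (Suc (Suc k)) \<odot> B) i j = (L \<odot> (mpow L (Suc k) \<odot> B)) i j"
      using row_finite_parity by (simp add: mmul_assoc row_finite_mpow row_finite_mmul)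
    then show ?case using P by (simp add: L Suc del: mpow.simps)
  qed (simp add: L)
  have "((if k = 0 then E else mpow L k) \<odot> B) i j = (if P i then B (i + 2 * k) j else 0)" for k
    by (cases k) (simp_all add: pow E_def diagm_mmul del: mpow.simps)
  then show ?thesis
    by (simp add: mpoly_mmul row_finite_parity)
qed

text \<open>Differentiation of x^(i div 2) on rows of parity \<open>P\<close>. For
  \<open>i < 2\<close> the factor \<open>i div 2\<close> is zero, so the truncated
  \<open>i - 2\<close> is harmless.\<close>

lemma Der_parity_mmul:
  "(D \<odot> B) i j = (if P i then real (i div 2) * B (i - 2) j else 0)"
proof -
  consider "i = 0" | "i = 1" | n where "i = Suc (Suc n)"
    by (metis One_nat_def not0_implies_Suc)
  then show ?thesis
  proof cases
    case 3
    then have "i div 2 = n div 2 + 1" by simp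
    then show ?thesis
      using 3 P by (simp add: D_def numeral_2_eq_2 mmul_assoc mtransp_Lam_mmul row_finite_mmul diagm_mmul)
  qed (simp_all add: D_def numeral_2_eq_2 mmul_assoc mtransp_Lam_mmul row_finite_mmul diagm_mmul)
qed

text \<open>\<open>B\<close> stands for the transposed moment matrix. With m = j div 2, the moment
  identity for x^(i+m) carries the factor i+m+k = m + (i+k): the part m is the derivation term on
  the left, the part i+k is the sum on the right.\<close>

lemma pearson_parity_mmul:
  assumes "is_interval \<Delta>" "finite_moments \<Delta> u" "pearson \<Delta> \<sigma> q u" "vanishes_at_boundary \<Delta> \<sigma> u"
    and B: "\<And>l i. P l \<Longrightarrow> B l i = moment \<Delta> u (i + l div 2)"
  shows "((D \<odot> mpoly \<sigma> E L + mpoly q E L) \<odot> B) j i =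
    (if P j then - (\<Sum>k\<le>degree \<sigma>. coeff \<sigma> k * (real (i + k) * B j (i + k - 1))) else 0)"
proof (cases "P j")
  case True
  define m where "m = j div 2"
  have D: "(D \<odot> (mpoly \<sigma> E L \<odot> B)) j i =
    (\<Sum>k\<le>degree \<sigma>. coeff \<sigma> k * (real m * moment \<Delta> u (i + (m - 1) + k)))"
  proof (cases "m = 0")
    case False
    then have "j \<ge> 2" by (auto simp: m_def)
    then obtain n where n: "j = Suc (Suc n)" by (metis add_2_eq_Suc le_Suc_ex)
    then have "P n" using True P by simp
    moreover have "m = Suc (n div 2)" by (simp add: m_def n)
    ultimately show ?thesis
      using True P parity_add_double[of n]
      by (simp add: Der_parity_mmul mpoly_parity_mmul B n sum_distrib_left mult_ac add_ac)
  qed (simp add: Der_parity_mmul m_def)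
  have *: "(mpoly q E L \<odot> B) j i = (\<Sum>k\<le>degree q. coeff q k * moment \<Delta> u (i + m + k))"
    using True parity_add_double[of j] by (simp add: mpoly_parity_mmul B m_def add_ac)
  \<comment> \<open>The cases \<open>m = 0\<close> and \<open>i + k = 0\<close> are those in which a
    subtraction truncates; there the corresponding factor is zero.\<close>
  have "real m * moment \<Delta> u (i + (m - 1) + k) + real (i + k) * moment \<Delta> u (i + k - 1 + m)
      = real (i + m + k) * moment \<Delta> u (i + m + k - 1)" for k
    by (cases "m = 0"; cases "i + k = 0") (auto simp: algebra_simps)
  then have "coeff \<sigma> k * (real m * moment \<Delta> u (i + (m - 1) + k)) =
      coeff \<sigma> k * (real (i + m + k) * moment \<Delta> u (i + m + k - 1)) -
      coeff \<sigma> k * (real (i + k) * B j (i + k - 1))" for k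
    using B[OF True, of "i + k - 1"] unfolding m_def[symmetric] by (metis add_diff_cancel_right' right_diff_distrib)
  with D * have "((D \<odot> mpoly \<sigma> E L + mpoly q E L) \<odot> B) j i =
      (\<Sum>k\<le>degree \<sigma>. coeff \<sigma> k * (real (i + m + k) * moment \<Delta> u (i + m + k - 1)))
      - (\<Sum>k\<le>degree \<sigma>. coeff \<sigma> k * (real (i + k) * B j (i + k - 1)))
      + (\<Sum>k\<le>degree q. coeff q k * moment \<Delta> u (i + m + k))"
    using row_finite_parity
    by (simp add: mmul_add_left row_finite_mmul row_finite_mpoly mmul_assoc sum_subtractf del: of_nat_add)
  then show ?thesis
    using True pearson_moments[OF assms(1-4), of "i + m"] by simp
next
  case False
  then show ?thesis
    using row_finite_parity
    by (simp add: mmul_add_left row_finite_mmul row_finite_mpoly mmul_assoc Der_parity_mmul mpoly_parity_mmul)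
qed

end

lemma pearson_moment_matrix:
  assumes "is_interval \<Delta>"
    and "finite_moments \<Delta> u1" "pearson \<Delta> \<sigma> q1 u1" "vanishes_at_boundary \<Delta> \<sigma> u1"
    and "finite_moments \<Delta> u2" "pearson \<Delta> \<sigma> q2 u2" "vanishes_at_boundary \<Delta> \<sigma> u2"
  defines "g \<equiv> moment_matrix \<Delta> u1 u2"
  shows "mpoly \<sigma> idm Lam \<odot> Der \<odot> g =
    - (g \<odot> mtransp (Der1 \<odot> mpoly \<sigma> Pi1 Lam1 + mpoly q1 Pi1 Lam1
        + (Der2 \<odot> mpoly \<sigma> Pi2 Lam2 + mpoly q2 Pi2 Lam2)))"
    (is "_ = - (g \<odot> mtransp (?M1 + ?M2))")
proof (intro ext)
  fix i j
  \<comment> \<open>Transposition turns right multiplication by the transposed operator into left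
    multiplication, for which the row formulas are available.\<close>
  let ?B = "mtransp g"
  note pm1 = pearson_parity_mmul[of even, OF _ Pi1_def Lam1_def Der1_def assms(1-4)]
  note pm2 = pearson_parity_mmul[of odd, OF _ Pi2_def Lam2_def Der2_def assms(1,5-7)]
  note rf1 = row_finite_parity[of even, OF _ Pi1_def Lam1_def Der1_def]
  note rf2 = row_finite_parity[of odd, OF _ Pi2_def Lam2_def Der2_def]
  have "row_finite ?M1" "row_finite ?M2"
    using rf1 rf2 by (auto intro!: row_finite_mpoly)
  then have "((?M1 + ?M2) \<odot> ?B) j i = (?M1 \<odot> ?B) j i + (?M2 \<odot> ?B) j i"
    by (simp add: mmul_add_left)
  \<comment> \<open>For each \<open>j\<close> only the summand matching its parity is nonzero: the
    first weight serves even \<open>j\<close>, the second odd \<open>j\<close>.\<close>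
  also have "\<dots> = - (\<Sum>k\<le>degree \<sigma>. coeff \<sigma> k * (real (i + k) * ?B j (i + k - 1)))"
    by (subst pm1, simp, simp add: mtransp_def g_def moment_matrix_entry)
      (subst pm2, simp, simp add: mtransp_def g_def moment_matrix_entry, simp)
  also have "\<dots> = - (mpoly \<sigma> idm Lam \<odot> Der \<odot> g) i j"
    by (simp add: mpoly_Lam_Der_mmul mtransp_def)
  finally have "(mpoly \<sigma> idm Lam \<odot> Der \<odot> g) i j = - mtransp ((?M1 + ?M2) \<odot> ?B) i j"
    by (simp add: mtransp_def)
  then show "(mpoly \<sigma> idm Lam \<odot> Der \<odot> g) i j = (- (g \<odot> mtransp (?M1 + ?M2))) i j"
    by (simp add: mtransp_mmul)
qed

section \<open>Dressing the moment identity by the Gauss-Borel factors\<close>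

theorem theorem4:
  fixes \<Delta> :: "real set" and v w1 w2 :: "real \<Rightarrow> real" and \<sigma> q1 q2 :: "real poly"
    and S St H :: smat and h :: "nat \<Rightarrow> real"
  assumes "is_interval \<Delta>"
    and "finite_moments \<Delta> (tilde v w1)" and "finite_moments \<Delta> (tilde v w2)"
    and "gauss_borel (moment_matrix \<Delta> (tilde v w1) (tilde v w2)) S h St"
    and "H = diagm h"
    and "pearson \<Delta> \<sigma> q1 (tilde v w1)" and "pearson \<Delta> \<sigma> q2 (tilde v w2)"
    and "vanishes_at_boundary \<Delta> \<sigma> (tilde v w1)" and "vanishes_at_boundary \<Delta> \<sigma> (tilde v w2)"
  shows "mpoly \<sigma> idm (Tm S) \<odot> Phi S =
    - mtransp (Phi1 H St \<odot> mpoly \<sigma> (C1 H St) (T1 H St)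
            + Phi2 H St \<odot> mpoly \<sigma> (C2 H St) (T2 H St)
            + mpoly q1 (C1 H St) (T1 H St) + mpoly q2 (C2 H St) (T2 H St))"
proof -
  define g where "g = moment_matrix \<Delta> (tilde v w1) (tilde v w2)"
  define K where "K = mpoly \<sigma> idm Lam \<odot> Der"
  define M where "M = Der1 \<odot> mpoly \<sigma> Pi1 Lam1 + mpoly q1 Pi1 Lam1
        + (Der2 \<odot> mpoly \<sigma> Pi2 Lam2 + mpoly q2 Pi2 Lam2)"
  define P where "P = minv H \<odot> St"
  define Q where "Q = minv St \<odot> H"
  have S: "row_finite S" "row_finite (minv S)" "S \<odot> minv S = idm" "minv S \<odot> S = idm"
    and St: "row_finite St" "row_finite (minv St)" "St \<odot> minv St = idm" "minv St \<odot> St = idm"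
    and h: "\<And>n. h n \<noteq> 0" and g: "g = minv S \<odot> H \<odot> mtransp (minv St)"
    using assms(4,5) unfolding gauss_borel_def g_def
    by (auto simp: row_finite_lower minv_lower_unitriangular)
  have H: "row_finite H" "row_finite (minv H)" "H \<odot> minv H = idm" "minv H \<odot> H = idm"
    using h by (auto simp: assms(5) minv_diagm fun_eq_iff diagm_mmul) (auto simp: idm_def diagm_def)
  have PQ: "row_finite P" "row_finite Q" "P \<odot> Q = idm" "Q \<odot> P = idm"
    unfolding P_def Q_def using H St
    by (auto simp: mmul_assoc row_finite_mmul)
       (metis mmul_assoc idm_mmul)+
  note rf1 = row_finite_parity[of even, OF _ Pi1_def Lam1_def Der1_def, simplified]
  note rf2 = row_finite_parity[of odd, OF _ Pi2_def Lam2_def Der2_def, simplified]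
  have rfD: "row_finite Der" by (auto simp: Der_def)
  have M: "row_finite M"
    unfolding M_def using rf1 rf2 by (auto intro!: row_finite_mpoly)
  have K: "row_finite K"
    unfolding K_def using rfD by (auto intro!: row_finite_mpoly)
  \<comment> \<open>Dressing is conjugation by \<open>P\<close> with inverse \<open>Q\<close>, so it
    respects products and polynomials.\<close>
  have dress: "dress H St N = P \<odot> N \<odot> Q" if "row_finite N" for N
    unfolding dress_def P_def Q_def using H St that by (simp add: mmul_assoc row_finite_mmul)
  have conj_mult: "(A \<odot> N \<odot> B) \<odot> (A \<odot> N' \<odot> B) = A \<odot> (N \<odot> N') \<odot> B"
    if "row_finite A" "row_finite B" "row_finite N" "row_finite N'" "B \<odot> A = idm" for A B N N'
  proof -
    have "B \<odot> (A \<odot> X) = X" for X using that by (metis mmul_assoc idm_mmul)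
    then show ?thesis using that by (simp add: mmul_assoc row_finite_mmul)
  qed
  have "Phi1 H St \<odot> mpoly \<sigma> (C1 H St) (T1 H St) + Phi2 H St \<odot> mpoly \<sigma> (C2 H St) (T2 H St)
      + mpoly q1 (C1 H St) (T1 H St) + mpoly q2 (C2 H St) (T2 H St) = P \<odot> M \<odot> Q"
    unfolding Phi1_def Phi2_def C1_def C2_def T1_def T2_def M_def
    using PQ rf1 rf2
    by (simp add: dress mpoly_conj conj_mult row_finite_mpoly row_finite_mmul row_finite_add
        mmul_add_left mmul_add_right)
  moreover have "mpoly \<sigma> idm (Tm S) \<odot> Phi S = S \<odot> K \<odot> minv S"
  proof -
    have "mpoly \<sigma> (S \<odot> idm \<odot> minv S) (S \<odot> Lam \<odot> minv S) = S \<odot> mpoly \<sigma> idm Lam \<odot> minv S"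
      using S by (intro mpoly_conj) auto
    then show ?thesis
      using S rfD by (simp add: Tm_def Phi_def K_def conj_mult row_finite_mpoly)
  qed
  moreover have "S \<odot> K \<odot> minv S = - mtransp (P \<odot> M \<odot> Q)"
  proof -
    have colH: "mtransp H = H" by (simp add: assms(5))
    have gQ: "g = minv S \<odot> mtransp Q"
      unfolding g Q_def using S H by (simp add: mtransp_mmul colH mmul_assoc)
    have QP: "mtransp Q \<odot> mtransp P = idm"
      using PQ by (metis idm_def mtransp_diagm mtransp_mmul)
    have Sg: "S \<odot> g = mtransp Q"
      using S by (simp add: gQ mmul_assoc[symmetric])
    \<comment> \<open>The identity is inserted so that \<open>minv S \<odot> mtransp Q\<close> can
      be recombined into \<open>g\<close>.\<close>
    have "S \<odot> K \<odot> minv S = S \<odot> K \<odot> minv S \<odot> (mtransp Q \<odot> mtransp P)"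
      by (simp add: QP)
    also have "\<dots> = (S \<odot> K \<odot> minv S \<odot> mtransp Q) \<odot> mtransp P"
      \<comment> \<open>The rows of \<open>mtransp Q\<close> may be infinite, but
        \<open>mtransp P\<close> has finite columns because \<open>P\<close> has finite
        rows.\<close>
      using S K PQ by (intro mmul_assoc_row_col[symmetric]) (auto intro!: row_finite_mmul)
    also have "S \<odot> K \<odot> minv S \<odot> mtransp Q = S \<odot> (K \<odot> g)"
      using S K by (simp add: gQ mmul_assoc row_finite_mmul)
    also have "K \<odot> g = - (g \<odot> mtransp M)"
      unfolding K_def M_def g_def using assms by (intro pearson_moment_matrix)
    also have "S \<odot> (- (g \<odot> mtransp M)) = - (mtransp Q \<odot> mtransp M)"
      using S M by (simp add: mmul_uminus_right mmul_assoc_row_col[symmetric] Sg)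
    also have "\<dots> \<odot> mtransp P = - mtransp (P \<odot> (M \<odot> Q))"
      by (simp only: uminus_mmul mtransp_mmul)
    also have "P \<odot> (M \<odot> Q) = P \<odot> M \<odot> Q"
      using PQ M by (simp add: mmul_assoc)
    finally show ?thesis .
  qed
  ultimately show ?thesis by simp
qed

end
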